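(* Let $k_A,k_B,\ell,k_1,k_2$ be integers such that $k_A,k_B\ge 2$ and $\ell=k_1+k_2+1$. Then the complete bipartite graph $G=(A\cup B,E)$ with $|A|=\overline{M}(k_1,k_A,\ell)$ and $|B|=\overline{M}(k_2,k_B,\ell)$ is not $(k_A,k_B)$-choosable.
   Context: For positive integers $k_1,k_2,\ell$, a family $\mathcal F$ of $k_2$-element subsets of $[\ell]=\{1,\dots,\ell\}$ has Property A$(k_1,k_2,\ell)$ if there is a $k_1$-element subset of $[\ell]$ that intersects every set in $\mathcal F$. $\overline{M}(k_1,k_2,\ell)$ denotes the minimum cardinality of a family of $k_2$-element subsets of $[\ell]$ that does not have Property A$(k_1,k_2,\ell)$ (equivalently, the minimum number of edges of a $k_2$-uniform hypergraph on $\ell$ vertices with no independent set of size $\ell-k_1$). For a bipartite graph $G=(A\cup B,E)$ with designated parts $A,B$, a $(k_A,k_B)$-list-assignment assigns to each vertex of $A$ a set of $k_A$ positive integers and to each vertex of $B$ a set of $k_B$ positive integers; $G$ is $(k_A,k_B)$-choosable if for every such assignment $L$ there is a proper colouring $c$ with $c(v)\in L(v)$ for all $v$. *)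

theory Defs
  imports Main "HOL-Library.Extended_Nat"
begin

definition uniform_family :: "nat \<Rightarrow> nat \<Rightarrow> nat set set \<Rightarrow> bool" where
  "uniform_family k l F \<longleftrightarrow> (\<forall>X\<in>F. X \<subseteq> {1..l} \<and> card X = k)"

text \<open>The set size \<open>k2\<close> of Property A\<open>(k1,k2,l)\<close> is carried by
  \<^term>\<open>uniform_family k2 l F\<close>, so that the negation of \<open>property_A\<close> below only negates
  the existence of a transversal.\<close>

definition property_A :: "nat \<Rightarrow> nat \<Rightarrow> nat set set \<Rightarrow> bool" where
  "property_A k1 l F \<longleftrightarrow> (\<exists>S. S \<subseteq> {1..l} \<and> card S = k1 \<and> (\<forall>X\<in>F. S \<inter> X \<noteq> {}))"

text \<open>A family without Property A exists only if \<open>k1 + k2 \<le> l\<close> or \<open>k1 > l\<close>.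
  If there is none, the minimum is undefined and \<open>Mbar\<close> takes the value \<open>\<infinity>\<close>
  (the infimum of the empty set), which is the cardinality of no finite set; otherwise the
  infimum is attained, since \<^typ>\<open>enat\<close> is well-ordered.\<close>

definition Mbar :: "nat \<Rightarrow> nat \<Rightarrow> nat \<Rightarrow> enat" where
  "Mbar k1 k2 l = (INF F \<in> {F. uniform_family k2 l F \<and> \<not> property_A k1 l F}. enat (card F))"

definition bipartite_graph :: "'a set \<Rightarrow> 'a set \<Rightarrow> 'a set set \<Rightarrow> bool" where
  "bipartite_graph A B E \<longleftrightarrow>
     finite A \<and> finite B \<and> A \<inter> B = {} \<and> (\<forall>e\<in>E. \<exists>a\<in>A. \<exists>b\<in>B. e = {a, b})"

definition complete_bipartite_graph :: "'a set \<Rightarrow> 'a set \<Rightarrow> 'a set set \<Rightarrow> bool" where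
  "complete_bipartite_graph A B E \<longleftrightarrow>
     bipartite_graph A B E \<and> (\<forall>a\<in>A. \<forall>b\<in>B. {a, b} \<in> E)"

definition list_assignment ::
  "'a set \<Rightarrow> 'a set \<Rightarrow> nat \<Rightarrow> nat \<Rightarrow> ('a \<Rightarrow> nat set) \<Rightarrow> bool" where
  "list_assignment A B kA kB L \<longleftrightarrow>
     (\<forall>v\<in>A. L v \<subseteq> {1..} \<and> finite (L v) \<and> card (L v) = kA) \<and>
     (\<forall>v\<in>B. L v \<subseteq> {1..} \<and> finite (L v) \<and> card (L v) = kB)"

definition proper_colouring :: "'a set set \<Rightarrow> ('a \<Rightarrow> nat) \<Rightarrow> bool" where
  "proper_colouring E c \<longleftrightarrow> (\<forall>u v. {u, v} \<in> E \<longrightarrow> c u \<noteq> c v)"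

definition choosable :: "'a set \<Rightarrow> 'a set \<Rightarrow> 'a set set \<Rightarrow> nat \<Rightarrow> nat \<Rightarrow> bool" where
  "choosable A B E kA kB \<longleftrightarrow>
     (\<forall>L. list_assignment A B kA kB L \<longrightarrow>
        (\<exists>c. proper_colouring E c \<and> (\<forall>v\<in>A \<union> B. c v \<in> L v)))"

end

theory Submission
  imports Defs
begin

text \<open>Use the members of extremal families on the colour set \<open>[l]\<close> as the lists on the two
  sides. The colours appearing on \<open>A\<close> meet every list of \<open>A\<close>, so there are more than \<open>k1\<close>
  of them; likewise more than \<open>k2\<close> colours appear on \<open>B\<close>. Since every vertex of \<open>A\<close> is
  adjacent to every vertex of \<open>B\<close>, these colour sets are disjoint, which requires
  \<open>k1 + k2 + 2 > l\<close> colours.\<close>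

text \<open>The infimum of no families is \<open>\<infinity>\<close>, so a finite value forces some
  family to exist; well-ordering of \<open>enat\<close> then makes one of them a minimiser.\<close>

lemma Mbar_attained:
  assumes "enat n = Mbar k1 k2 l"
  obtains F where "uniform_family k2 l F" "\<not> property_A k1 l F" "card F = n"
proof -
  let ?\<F> = "{F. uniform_family k2 l F \<and> \<not> property_A k1 l F}"
  have "?\<F> \<noteq> {}"
  proof
    assume "?\<F> = {}"
    then have "Mbar k1 k2 l = \<infinity>"
      unfolding Mbar_def by (simp add: Inf_enat_def)
    with assms show False by simp
  qed
  then obtain F where "F \<in> ?\<F>" by blast
  then have "Mbar k1 k2 l \<in> (\<lambda>F. enat (card F)) ` ?\<F>"
    unfolding Mbar_def by (rule wellorder_InfI[OF imageI])
  with assms that show thesis by auto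
qed

lemma uniform_family_finite: "uniform_family k l F \<Longrightarrow> finite F"
  unfolding uniform_family_def by (rule finite_subset[of _ "Pow {1..l}"]) auto

lemma uniform_family_lists:
  assumes "uniform_family k l F" "X \<in> F"
  shows "X \<subseteq> {1..} \<and> finite X \<and> card X = k"
proof -
  have "X \<subseteq> {1..l}" "card X = k"
    using assms unfolding uniform_family_def by auto
  then show ?thesis
    using finite_subset by fastforce
qed

text \<open>\<open>property_A\<close> asks for exactly \<open>k\<close> elements. A transversal with
  fewer can be padded to size \<open>k\<close> inside \<open>{1..l}\<close>, as
  \<open>k \<le> l\<close>, and enlarging it keeps every intersection nonempty.\<close>

lemma card_transversal_gt:
  assumes "\<not> property_A k l F" "k \<le> l" "S \<subseteq> {1..l}" "\<forall>X\<in>F. S \<inter> X \<noteq> {}"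
  shows "k < card S"
proof (rule ccontr)
  assume "\<not> k < card S"
  then have "card S \<le> k" "k \<le> card {1..l}" using assms(2) by simp_all
  from exists_subset_between[OF this assms(3)]
  obtain T where T: "S \<subseteq> T" "T \<subseteq> {1..l}" "card T = k" by auto
  then have "\<forall>X\<in>F. T \<inter> X \<noteq> {}" using assms(4) by fast
  with T assms(1) show False unfolding property_A_def by metis
qed

text \<open>Each member of \<open>F\<close> is the list of some vertex and contains the colour
  chosen there, so the colours used on \<open>V\<close> form a transversal of
  \<open>F\<close>.\<close>

lemma card_colours_gt:
  assumes "uniform_family r l F" "\<not> property_A k l F" "k \<le> l"
    and "L ` V = F" "\<forall>v\<in>V. c v \<in> L v"
  shows "c ` V \<subseteq> {1..l}" "k < card (c ` V)"
proof -
  show sub: "c ` V \<subseteq> {1..l}"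
  proof
    fix x assume "x \<in> c ` V"
    then obtain v where "v \<in> V" "x \<in> L v" using assms(5) by auto
    moreover from this have "L v \<subseteq> {1..l}"
      using assms(1,4) unfolding uniform_family_def by auto
    ultimately show "x \<in> {1..l}" by auto
  qed
  have "\<forall>X\<in>F. c ` V \<inter> X \<noteq> {}"
    unfolding assms(4)[symmetric] using assms(5) by auto
  then show "k < card (c ` V)"
    by (rule card_transversal_gt[OF assms(2,3) sub])
qed

theorem theorem1p6:
  fixes kA kB l k1 k2 :: nat
    and A B :: "'a set" and E :: "'a set set"
  assumes "kA \<ge> 2" and "kB \<ge> 2"
    and "k1 \<ge> 1" and "k2 \<ge> 1"
    and "l = k1 + k2 + 1"
    and "complete_bipartite_graph A B E"
    and "enat (card A) = Mbar k1 kA l"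
    and "enat (card B) = Mbar k2 kB l"
  shows "\<not> choosable A B E kA kB"
proof
  assume choosable: "choosable A B E kA kB"
  have graph: "finite A" "finite B" "A \<inter> B = {}" "\<forall>a\<in>A. \<forall>b\<in>B. {a, b} \<in> E"
    using assms(6) unfolding complete_bipartite_graph_def bipartite_graph_def by auto
  obtain F where F: "uniform_family kA l F" "\<not> property_A k1 l F" "card F = card A"
    using Mbar_attained[OF assms(7)] .
  obtain G where G: "uniform_family kB l G" "\<not> property_A k2 l G" "card G = card B"
    using Mbar_attained[OF assms(8)] .
  \<comment> \<open>Equal cardinalities of finite sets let each member of the family serve as the
    list of exactly one vertex; surjectivity is what yields a transversal later.\<close>
  obtain f where f: "bij_betw f A F"
    using finite_same_card_bij[OF graph(1) uniform_family_finite[OF F(1)]] F(3) by auto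
  obtain g where g: "bij_betw g B G"
    using finite_same_card_bij[OF graph(2) uniform_family_finite[OF G(1)]] G(3) by auto
  define L where "L v = (if v \<in> A then f v else g v)" for v
  have LA: "L ` A = F" and LB: "L ` B = G"
    using f g graph(3) by (auto simp: L_def bij_betw_def image_def)
  have "L v \<subseteq> {1..} \<and> finite (L v) \<and> card (L v) = kA" if "v \<in> A" for v
    using uniform_family_lists[OF F(1)] LA that by auto
  moreover have "L v \<subseteq> {1..} \<and> finite (L v) \<and> card (L v) = kB" if "v \<in> B" for v
    using uniform_family_lists[OF G(1)] LB that by auto
  ultimately have "list_assignment A B kA kB L"
    unfolding list_assignment_def by blast
  then obtain c where c: "proper_colouring E c" "\<forall>v\<in>A \<union> B. c v \<in> L v"
    using choosable unfolding choosable_def by blast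
  have cA: "c ` A \<subseteq> {1..l}" "k1 < card (c ` A)"
    using card_colours_gt[OF F(1,2) _ LA] c(2) assms(5) by auto
  have cB: "c ` B \<subseteq> {1..l}" "k2 < card (c ` B)"
    using card_colours_gt[OF G(1,2) _ LB] c(2) assms(5) by auto
  \<comment> \<open>A shared colour would sit on both ends of an edge, by completeness.\<close>
  have "c ` A \<inter> c ` B = {}"
    using c(1) graph(4) unfolding proper_colouring_def by blast
  then have "card (c ` A) + card (c ` B) = card (c ` A \<union> c ` B)"
    using graph(1,2) by (simp add: card_Un_disjoint)
  also have "\<dots> \<le> card {1..l}"
    using cA(1) cB(1) by (intro card_mono) auto
  finally show False using cA(2) cB(2) assms(5) by simp
qed

end
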